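(* Let $$\xi^*=\inf\Big\{\sum_{k\in\mathcal K}\|\hat x^k-\tilde x^k\|_\ell\;:\;\tilde{\mathcal X}=(\tilde x^1,\dots,\tilde x^K)\in(\mathbb R^n)^K,\ \hat{\mathcal C}\cap\tilde{\mathcal C}=\emptyset\Big\}$$ be the inverse stability value for $\mathbf{QIO}(\mathcal K,\tau,\theta)$, where $\hat{\mathcal C}$ and $\tilde{\mathcal C}$ are the sets of inverse-feasible cost vectors for $\mathbf{QIO}(\hat{\mathcal X},\tau,\theta)$ and $\mathbf{QIO}(\tilde{\mathcal X},\tau,\theta)$ respectively. Let $(\bar v,\bar u,\{\bar\epsilon^k\}_{k\in\mathcal K})$ with $\bar v\ne0$ be a feasible solution of the mixed-integer system (MIP), let $\bar{\mathcal I}=\{i\in\mathcal I:\bar v_i=1\}$, let $d^*_{ik}=\min_{x\in\mathcal X_i}\|\hat x^k-x\|_\ell$ for $i\in\bar{\mathcal I}$, $k\in\mathcal K$, and let $d^*_{i[k]}$ denote the $k$-th largest value among $d^*_{i1},\dots,d^*_{iK}$. Then $$\max_{i\in\bar{\mathcal I}}\ \Big\{\sum_{k=1}^{\lfloor(1-\theta)K\rfloor+1}\max\big(0,\ \tau-d^*_{i[k]}\big)\Big\}\ \le\ \xi^*.$$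
   Context: Setting: $A\in\mathbb R^{m\times n}$, $b\in\mathbb R^m$, $\mathcal I=\{1,\dots,m\}$; $a^i\in\mathbb R^n$ is the $i$-th row of $A$ written as a column vector; prime denotes transpose. The forward feasible region $\mathcal X=\{x\in\mathbb R^n: Ax\ge b\}$ is bounded, full-dimensional and free of redundant constraints; $\mathcal X_i=\{x\in\mathcal X:{a^i}'x=b_i\}$. Norm parameters $\ell,p\ge1$ (possibly $\infty$) are fixed, and $\|a^i\|_p=1$ for all $i$. The dataset $\hat{\mathcal X}=\{\hat x^1,\dots,\hat x^K\}\subset\mathbb R^n$ is indexed by $\mathcal K=\{1,\dots,K\}$, with no assumption on feasibility or optimality of the points. $\tau\ge0$ and $\theta\in(0,1]$. Data noise is a point-wise shift: $\tilde x^k=\hat x^k+\delta^k$ with $\delta^k\in\mathbb R^n$ for each $k$. The infimum of the empty set is $+\infty$. Quantile inverse optimization problem $\mathbf{QIO}(\mathcal K,\tau,\theta)=\mathbf{QIO}(\hat{\mathcal X},\tau,\theta)$: find $c\in\mathbb R^n$, $\{\epsilon^k\}_{k\in\mathcal K}\subset\mathbb R^n$, $y\in\mathbb R^m$, $\mathcal S\subseteq\mathcal K$ such that $A'y=c$, $y\ge0$; $A(\hat x^k-\epsilon^k)\ge b$, $c'(\hat x^k-\epsilon^k)=b'y$ and $\|\epsilon^k\|_\ell\le\tau$ for all $k\in\mathcal S$; $|\mathcal S|\ge\theta K$; and $\|c\|_p=1$. A cost vector $c$ is inverse-feasible if it is the $c$-component of such a feasible solution. System (MIP), in $v\in\{0,1\}^m$,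 $u\in\{0,1\}^K$, $\epsilon^k\in\mathbb R^n$ ($k\in\mathcal K$): $b_i\le {a^i}'(\hat x^k-\epsilon^k)\le b_i+M_1(1-v_i)$ for all $i\in\mathcal I,k\in\mathcal K$; $\|\epsilon^k\|_\ell\le\tau+M_2(1-u_k)$ for all $k\in\mathcal K$; $\sum_{k=1}^K u_k\ge\theta K$. Here $M_1,M_2$ are sufficiently large constants, i.e. $M_1\ge\max_{i\in\mathcal I,x\in\mathcal X}({a^i}'x-b_i)$ and $M_2\ge\max_{k\in\mathcal K,x\in\mathcal X}\|\hat x^k-x\|_\ell$. *)

theory Defs
  imports "HOL-Analysis.Analysis"
begin

text \<open>Only used for \<open>1 \<le> p\<close>. For \<open>p = \<infinity>\<close>, \<open>infnorm\<close> is the maximum of the absolute values of the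
  components.\<close>

definition pnorm :: "ereal \<Rightarrow> real ^ 'n \<Rightarrow> real" where
  "pnorm p x =
    (if p = \<infinity> then infnorm x
     else (\<Sum>j\<in>UNIV. \<bar>x $ j\<bar> powr real_of_ereal p) powr (1 / real_of_ereal p))"

definition feasible_region :: "real ^ 'n ^ 'm \<Rightarrow> real ^ 'm \<Rightarrow> (real ^ 'n) set" where
  "feasible_region A b = {x. b \<le> A *v x}"

definition facet :: "real ^ 'n ^ 'm \<Rightarrow> real ^ 'm \<Rightarrow> 'm \<Rightarrow> (real ^ 'n) set" where
  "facet A b i = {x \<in> feasible_region A b. row i A \<bullet> x = b $ i}"

definition redundant_constraint :: "real ^ 'n ^ 'm \<Rightarrow> real ^ 'm \<Rightarrow> 'm \<Rightarrow> bool" where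
  "redundant_constraint A b i \<longleftrightarrow>
    {x. \<forall>j. j \<noteq> i \<longrightarrow> b $ j \<le> row j A \<bullet> x} = feasible_region A b"

text \<open>A dataset is a function on \<open>nat\<close> of which only the values on \<open>{1..K}\<close> matter; the same
  holds for the families of perturbations \<open>\<epsilon>\<close>.\<close>

definition qio_feasible ::
  "real ^ 'n ^ 'm \<Rightarrow> real ^ 'm \<Rightarrow> ereal \<Rightarrow> ereal \<Rightarrow> nat \<Rightarrow> (nat \<Rightarrow> real ^ 'n) \<Rightarrow> real \<Rightarrow> real \<Rightarrow>
    real ^ 'n \<Rightarrow> (nat \<Rightarrow> real ^ 'n) \<Rightarrow> real ^ 'm \<Rightarrow> nat set \<Rightarrow> bool" where
  "qio_feasible A b l p K xs \<tau> \<theta> c \<epsilon> y S \<longleftrightarrow>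
     transpose A *v y = c \<and> 0 \<le> y \<and>
     S \<subseteq> {1..K} \<and>
     (\<forall>k\<in>S. b \<le> A *v (xs k - \<epsilon> k) \<and> c \<bullet> (xs k - \<epsilon> k) = b \<bullet> y \<and> pnorm l (\<epsilon> k) \<le> \<tau>) \<and>
     real (card S) \<ge> \<theta> * real K \<and>
     pnorm p c = 1"

definition inverse_feasible_costs ::
  "real ^ 'n ^ 'm \<Rightarrow> real ^ 'm \<Rightarrow> ereal \<Rightarrow> ereal \<Rightarrow> nat \<Rightarrow> (nat \<Rightarrow> real ^ 'n) \<Rightarrow> real \<Rightarrow> real \<Rightarrow>
    (real ^ 'n) set" where
  "inverse_feasible_costs A b l p K xs \<tau> \<theta> =
     {c. \<exists>\<epsilon> y S. qio_feasible A b l p K xs \<tau> \<theta> c \<epsilon> y S}"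

text \<open>The infimum is taken in \<open>ereal\<close>, so that it is \<open>\<infinity>\<close> if no dataset makes the two sets of
  inverse-feasible cost vectors disjoint.\<close>

definition inverse_stability_value ::
  "real ^ 'n ^ 'm \<Rightarrow> real ^ 'm \<Rightarrow> ereal \<Rightarrow> ereal \<Rightarrow> nat \<Rightarrow> (nat \<Rightarrow> real ^ 'n) \<Rightarrow> real \<Rightarrow> real \<Rightarrow>
    ereal" where
  "inverse_stability_value A b l p K xs \<tau> \<theta> =
     (INF xt \<in> {xt. inverse_feasible_costs A b l p K xs \<tau> \<theta> \<inter>
                    inverse_feasible_costs A b l p K xt \<tau> \<theta> = {}}.
        ereal (\<Sum>k\<in>{1..K}. pnorm l (xs k - xt k)))"

definition mip_feasible ::
  "real ^ 'n ^ 'm \<Rightarrow> real ^ 'm \<Rightarrow> ereal \<Rightarrow> nat \<Rightarrow> (nat \<Rightarrow> real ^ 'n) \<Rightarrow> real \<Rightarrow> real \<Rightarrow> real \<Rightarrow> real \<Rightarrow>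
    real ^ 'm \<Rightarrow> (nat \<Rightarrow> real) \<Rightarrow> (nat \<Rightarrow> real ^ 'n) \<Rightarrow> bool" where
  "mip_feasible A b l K xs \<tau> \<theta> M1 M2 v u \<epsilon> \<longleftrightarrow>
     (\<forall>i. v $ i \<in> {0, 1}) \<and> (\<forall>k\<in>{1..K}. u k \<in> {0, 1}) \<and>
     (\<forall>i. \<forall>k\<in>{1..K}. b $ i \<le> row i A \<bullet> (xs k - \<epsilon> k) \<and>
                     row i A \<bullet> (xs k - \<epsilon> k) \<le> b $ i + M1 * (1 - v $ i)) \<and>
     (\<forall>k\<in>{1..K}. pnorm l (\<epsilon> k) \<le> \<tau> + M2 * (1 - u k)) \<and>
     (\<Sum>k\<in>{1..K}. u k) \<ge> \<theta> * real K"

text \<open>\<open>LEAST\<close> is the minimum of the set of distances; it is attained when the feasible region is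
  bounded and the facet is nonempty, since the facet is then compact.\<close>

definition facet_dist ::
  "real ^ 'n ^ 'm \<Rightarrow> real ^ 'm \<Rightarrow> ereal \<Rightarrow> (nat \<Rightarrow> real ^ 'n) \<Rightarrow> 'm \<Rightarrow> nat \<Rightarrow> real" where
  "facet_dist A b l xs i k = (LEAST r. r \<in> (\<lambda>x. pnorm l (xs k - x)) ` facet A b i)"

text \<open>The \<open>k\<close>-th largest of the values \<open>d 1, \<dots>, d K\<close>, counted with multiplicity, for \<open>k\<close> in
  \<open>{1..K}\<close>.\<close>

definition kth_largest :: "(nat \<Rightarrow> real) \<Rightarrow> nat \<Rightarrow> nat \<Rightarrow> real" where
  "kth_largest d K k = rev (sort (map d [1..<Suc K])) ! (k - 1)"

end

theory Submission
  imports Defs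
begin

text \<open>If \<open>v\<^sub>i = 1\<close>, the perturbed points selected by the mixed-integer system lie on the facet of
  constraint \<open>i\<close>, so the row \<open>a\<^sup>i\<close> is inverse-feasible for the original data. A dataset whose
  inverse-feasible costs avoid \<open>a\<^sup>i\<close> must have fewer than \<open>\<theta> K\<close> points within distance \<open>\<tau>\<close> of that
  facet, hence at least \<open>\<lfloor>(1 - \<theta>) K\<rfloor> + 1\<close> points farther than \<open>\<tau>\<close> from it. By the triangle inequality
  each such point has been moved by at least \<open>max 0 (\<tau> - d\<^sub>i\<^sub>k)\<close>, and the cheapest choice of these
  points takes those with the largest distances.\<close>

section \<open>The norms\<close>

text \<open>Extends the convexity of \<open>powr\<close> on the positive reals to the boundary. When
  \<open>s\<close> or \<open>t\<close> is 0, one term vanishes and the rest follows from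
  \<open>c powr p \<le> c\<close> for \<open>c\<close> in [0, 1].\<close>

lemma powr_convex_nonneg:
  fixes p s t :: real
  assumes "1 \<le> p" "0 \<le> s" "0 \<le> t" "0 \<le> c" "0 \<le> d" "c + d = 1"
  shows "(c * s + d * t) powr p \<le> c * s powr p + d * t powr p"
proof -
  have scale: "(c * r) powr p \<le> c * r powr p" if "0 \<le> c" "c \<le> 1" "0 \<le> r" for c r :: real
  proof -
    have "c powr p \<le> c powr 1"
      using that \<open>1 \<le> p\<close> by (intro powr_mono') auto
    then show ?thesis
      using that by (auto simp: powr_mult intro: mult_right_mono)
  qed
  consider "s = 0" | "t = 0" | "0 < s" "0 < t"
    using assms by linarith
  then show ?thesis
  proof cases
    case 3
    have "c = 1 - d"
      using assms by simp
    then show ?thesis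
      using convex_onD[OF powr_convex[OF \<open>1 \<le> p\<close>], of d s t] assms 3
      unfolding \<open>c = 1 - d\<close> by simp
  qed (use scale[of d t] scale[of c s] assms in auto)
qed

text \<open>After division by \<open>N f\<close> and \<open>N g\<close>, the p-th powers sum to 1.
  Pointwise convexity with the weights \<open>N f / s\<close> and \<open>N g / s\<close>, where
  \<open>s = N f + N g\<close>, then bounds the sum by \<open>s powr p\<close>. If
  \<open>N f\<close> or \<open>N g\<close> is 0, that function vanishes on \<open>I\<close>.\<close>

lemma Minkowski_sum:
  fixes f g :: "'a \<Rightarrow> real" and p :: real
  assumes "1 \<le> p" "finite I"
  defines "N \<equiv> \<lambda>f. (\<Sum>j\<in>I. \<bar>f j\<bar> powr p) powr (1 / p)"
  shows "N (\<lambda>j. f j + g j) \<le> N f + N g"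
proof -
  have N_powr: "N h powr p = (\<Sum>j\<in>I. \<bar>h j\<bar> powr p)" for h
    using \<open>1 \<le> p\<close> by (simp add: N_def powr_powr sum_nonneg)
  have N_ge: "N h \<ge> 0" for h
    by (simp add: N_def)
  have N_eq_0: "\<forall>j\<in>I. h j = 0" if "N h = 0" for h
    using N_powr[of h] that \<open>finite I\<close> by (simp add: sum_nonneg_eq_0_iff)
  consider "N f = 0" | "N g = 0" | "0 < N f" "0 < N g"
    using N_ge[of f] N_ge[of g] by linarith
  then show ?thesis
  proof cases
    case 1
    have "N (\<lambda>j. f j + g j) = N g"
      unfolding N_def using N_eq_0[OF 1] by simp
    then show ?thesis
      using 1 by simp
  next
    case 2
    have "N (\<lambda>j. f j + g j) = N f"
      unfolding N_def using N_eq_0[OF 2] by simp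
    then show ?thesis
      using 2 by simp
  next
    case 3
    define s where "s = N f + N g"
    have s: "s > 0"
      using 3 by (simp add: s_def)
    have weights: "N f / s + N g / s = 1"
      using s by (simp add: s_def flip: add_divide_distrib)
    have normalized: "(\<Sum>j\<in>I. (\<bar>h j\<bar> / N h) powr p) = 1" if "0 < N h" for h
    proof -
      have "(\<Sum>j\<in>I. (\<bar>h j\<bar> / N h) powr p) = (\<Sum>j\<in>I. \<bar>h j\<bar> powr p) / N h powr p"
        using that by (simp add: powr_divide sum_divide_distrib)
      then show ?thesis
        using that by (simp add: N_powr[symmetric])
    qed
    have "\<bar>f j + g j\<bar> powr p
        \<le> s powr p * (N f / s * (\<bar>f j\<bar> / N f) powr p + N g / s * (\<bar>g j\<bar> / N g) powr p)" for j
    proof -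
      have "\<bar>f j + g j\<bar> powr p \<le> (\<bar>f j\<bar> + \<bar>g j\<bar>) powr p"
        using \<open>1 \<le> p\<close> by (intro powr_mono2) auto
      also have "\<bar>f j\<bar> + \<bar>g j\<bar> = s * (N f / s * (\<bar>f j\<bar> / N f) + N g / s * (\<bar>g j\<bar> / N g))"
        using s 3 by (simp add: distrib_left)
      also have "\<dots> powr p = s powr p * (N f / s * (\<bar>f j\<bar> / N f) + N g / s * (\<bar>g j\<bar> / N g)) powr p"
        by (rule powr_mult)
      also have "\<dots> \<le> s powr p * (N f / s * (\<bar>f j\<bar> / N f) powr p + N g / s * (\<bar>g j\<bar> / N g) powr p)"
        using s 3 \<open>1 \<le> p\<close> weights by (intro mult_left_mono powr_convex_nonneg) auto
      finally show ?thesis .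
    qed
    then have "(\<Sum>j\<in>I. \<bar>f j + g j\<bar> powr p)
        \<le> (\<Sum>j\<in>I. s powr p * (N f / s * (\<bar>f j\<bar> / N f) powr p + N g / s * (\<bar>g j\<bar> / N g) powr p))"
      by (intro sum_mono) auto
    also have "\<dots> = s powr p * (N f / s + N g / s)"
      by (simp only: sum.distrib sum_distrib_left[symmetric] normalized 3 mult_1_right)
    also have "\<dots> = s powr p"
      by (simp add: weights)
    finally have "N (\<lambda>j. f j + g j) \<le> (s powr p) powr (1 / p)"
      unfolding N_def using \<open>1 \<le> p\<close> by (intro powr_mono2) (auto intro: sum_nonneg)
    then show ?thesis
      using s \<open>1 \<le> p\<close> by (simp add: powr_powr s_def)
  qed
qed

lemma one_le_real_of_ereal:
  assumes "1 \<le> l" "l \<noteq> \<infinity>"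
  shows "1 \<le> real_of_ereal l"
  using assms by (cases l) auto

lemma pnorm_triangle:
  assumes "1 \<le> l"
  shows "pnorm l (x + y) \<le> pnorm l x + pnorm l y"
  using Minkowski_sum[OF one_le_real_of_ereal[OF assms], of UNIV "($) x" "($) y"]
  by (simp add: pnorm_def infnorm_triangle)

lemma pnorm_nonneg: "0 \<le> pnorm l x"
  by (simp add: pnorm_def infnorm_pos_le)

lemma continuous_on_pnorm_diff:
  assumes "1 \<le> l"
  shows "continuous_on S (\<lambda>x. pnorm l (a - x))"
proof (cases "l = \<infinity>")
  case True
  then show ?thesis
    by (auto simp: pnorm_def intro!: continuous_intros)
next
  case False
  then have "0 < real_of_ereal l"
    using one_le_real_of_ereal[OF assms] by simp
  then show ?thesis
    using False
    by (auto simp: pnorm_def sum_nonneg intro!: continuous_intros continuous_on_powr')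
qed

section \<open>Distances to the facets\<close>

lemma row_inner: "row i A \<bullet> x = (A *v x) $ i"
  for A :: "real ^ 'n ^ 'm"
  by (simp add: matrix_vector_mult_def row_def inner_vec_def)

lemma feasible_region_iff: "x \<in> feasible_region A b \<longleftrightarrow> (\<forall>i. b $ i \<le> row i A \<bullet> x)"
  by (simp add: feasible_region_def less_eq_vec_def row_inner)

lemma compact_facet:
  assumes "bounded (feasible_region A b)"
  shows "compact (facet A b i)"
proof -
  have "facet A b i = (\<Inter>j. {x. b $ j \<le> row j A \<bullet> x}) \<inter> {x. row i A \<bullet> x = b $ i}"
    by (auto simp: facet_def feasible_region_iff)
  moreover have "closed \<dots>"
    by (intro closed_Int closed_INT ballI closed_Collect_le closed_Collect_eq continuous_intros)
  moreover have "bounded (facet A b i)"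
    using assms by (rule bounded_subset) (auto simp: facet_def)
  ultimately show ?thesis
    by (simp add: compact_eq_bounded_closed)
qed

text \<open>\<open>LEAST\<close> on the reals is meaningful only if a minimum exists; here a
  continuous function is minimized over a nonempty compact facet.\<close>

lemma facet_dist_attained:
  assumes "1 \<le> l" "bounded (feasible_region A b)" "facet A b i \<noteq> {}"
  obtains x where "x \<in> facet A b i" "facet_dist A b l xs i k = pnorm l (xs k - x)"
proof -
  obtain x where x: "x \<in> facet A b i" "\<forall>y\<in>facet A b i. pnorm l (xs k - x) \<le> pnorm l (xs k - y)"
    using continuous_attains_inf[OF compact_facet[OF assms(2)] assms(3)
        continuous_on_pnorm_diff[OF assms(1)]] by blast
  then have "facet_dist A b l xs i k = pnorm l (xs k - x)"
    unfolding facet_dist_def by (intro Least_equality) auto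
  then show thesis
    using that x by blast
qed

lemma row_inverse_feasible:
  assumes "pnorm p (row i A) = 1" "S \<subseteq> {1..K}" "real (card S) \<ge> \<theta> * real K"
    and near: "\<And>k. k \<in> S \<Longrightarrow> \<exists>x\<in>facet A b i. pnorm l (xs k - x) \<le> \<tau>"
  shows "row i A \<in> inverse_feasible_costs A b l p K xs \<tau> \<theta>"
proof -
  obtain x where x: "\<And>k. k \<in> S \<Longrightarrow> x k \<in> facet A b i \<and> pnorm l (xs k - x k) \<le> \<tau>"
    using near by metis
  \<comment> \<open>The dual witness is the i-th unit vector. With it,
    \<open>c \<bullet> x = b \<bullet> y\<close> becomes the equation
    \<open>row i A \<bullet> x = b $ i\<close> that defines the facet.\<close>
  have "transpose A *v axis i 1 = row i A"
    by (simp add: matrix_vector_mult_basis column_transpose)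
  moreover have "0 \<le> (axis i 1 :: real ^ 'b)"
    by (simp add: less_eq_vec_def axis_def)
  moreover have "b \<bullet> axis i 1 = b $ i"
    by (simp add: inner_axis)
  ultimately have "qio_feasible A b l p K xs \<tau> \<theta> (row i A) (\<lambda>k. xs k - x k) (axis i 1) S"
    using assms x by (auto simp: qio_feasible_def facet_def feasible_region_def)
  then show ?thesis
    unfolding inverse_feasible_costs_def by blast
qed

text \<open>For \<open>v $ i = 1\<close> the \<open>M1\<close> term vanishes, so the lower and upper
  bounds on row \<open>i\<close> coincide. This applies to every \<open>k\<close>, since these
  constraints do not involve \<open>u\<close>.\<close>

lemma mip_facet:
  assumes "mip_feasible A b l K xs \<tau> \<theta> M1 M2 v u \<epsilon>" "v $ i = 1" "k \<in> {1..K}"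
  shows "xs k - \<epsilon> k \<in> facet A b i"
proof -
  have "b $ j \<le> row j A \<bullet> (xs k - \<epsilon> k)"
    "row j A \<bullet> (xs k - \<epsilon> k) \<le> b $ j + M1 * (1 - v $ j)" for j
    using assms by (auto simp: mip_feasible_def)
  from this(1) this[of i] show ?thesis
    using assms(2) by (auto simp: facet_def feasible_region_iff intro: antisym)
qed

lemma mip_row_inverse_feasible:
  assumes "mip_feasible A b l K xs \<tau> \<theta> M1 M2 v u \<epsilon>" "v $ i = 1" "pnorm p (row i A) = 1"
  shows "row i A \<in> inverse_feasible_costs A b l p K xs \<tau> \<theta>"
proof (rule row_inverse_feasible[OF assms(3)])
  \<comment> \<open>For these \<open>k\<close> the \<open>M2\<close> term vanishes, so
    \<open>\<epsilon> k\<close> has norm at most \<open>\<tau>\<close>.\<close>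
  let ?S = "{k \<in> {1..K}. u k = 1}"
  have u: "u k = 0 \<or> u k = 1" "pnorm l (\<epsilon> k) \<le> \<tau> + M2 * (1 - u k)" if "k \<in> {1..K}" for k
    using assms(1) that by (auto simp: mip_feasible_def)
  show "?S \<subseteq> {1..K}"
    by auto
  have "(\<Sum>k\<in>{1..K}. u k) = (\<Sum>k\<in>{1..K}. if u k = 1 then 1 else 0)"
    using u by (intro sum.cong) auto
  also have "\<dots> = real (card ?S)"
    by (simp flip: sum.inter_filter)
  finally show "real (card ?S) \<ge> \<theta> * real K"
    using assms(1) by (simp add: mip_feasible_def)
  show "\<exists>x\<in>facet A b i. pnorm l (xs k - x) \<le> \<tau>" if "k \<in> ?S" for k
    using mip_facet[OF assms(1,2), of k] u(2)[of k] that
    by (intro bexI[of _ "xs k - \<epsilon> k"]) auto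
qed

section \<open>Sums over the largest values\<close>

text \<open>An exchange argument: \<open>{..<N} - T\<close> and \<open>T - {..<N}\<close> have equal
  size, and for \<open>N = Suc m\<close> the value \<open>g m\<close> bounds \<open>g\<close> from
  above on the first set and from below on the second.\<close>

lemma sum_lessThan_le_sum_subset:
  fixes g :: "nat \<Rightarrow> real"
  assumes "mono_on {..<K} g" "T \<subseteq> {..<K}" "card T = N"
  shows "(\<Sum>j<N. g j) \<le> (\<Sum>j\<in>T. g j)"
proof (cases N)
  case (Suc m)
  have fin: "finite T"
    using assms(2) finite_subset by blast
  have "m < K"
    using card_mono[OF _ assms(2)] assms(3) Suc by simp
  have "card ({..<N} - T) = card (T - {..<N})"
    using card_Diff_subset_Int[of "{..<N}" T] card_Diff_subset_Int[of T "{..<N}"] fin assms(3)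
    by (simp add: Int_commute)
  moreover have "(\<Sum>j\<in>{..<N} - T. g j) \<le> real (card ({..<N} - T)) * g m"
    using \<open>m < K\<close> Suc by (intro sum_bounded_above mono_onD[OF assms(1)]) auto
  moreover have "real (card (T - {..<N})) * g m \<le> (\<Sum>j\<in>T - {..<N}. g j)"
    using \<open>m < K\<close> Suc assms(2) by (intro sum_bounded_below mono_onD[OF assms(1)]) auto
  ultimately have "(\<Sum>j\<in>{..<N} - T. g j) \<le> (\<Sum>j\<in>T - {..<N}. g j)"
    by simp
  then show ?thesis
    using sum.Int_Diff[of "{..<N}" g T] sum.Int_Diff[of T g "{..<N}"] fin
    by (simp add: Int_commute)
next
  case 0
  have "finite T"
    using assms(2) finite_subset by blast
  then show ?thesis
    using 0 assms(3) by simp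
qed

text \<open>Passes from sorted values to sorted indices, so that tied values still belong to
  distinct indices. Ranks start at 1, the enumeration at 0.\<close>

lemma kth_largest_enumeration:
  obtains \<pi> where "bij_betw \<pi> {..<K} {1..K}"
    "\<And>j. j < K \<Longrightarrow> kth_largest d K (Suc j) = d (\<pi> j)"
    "antimono_on {..<K} (\<lambda>j. d (\<pi> j))"
proof -
  \<comment> \<open>Sorting the indices by the key \<open>d\<close> and then applying
    \<open>d\<close> gives the sorted list of values.\<close>
  define zs where "zs = rev (sort_key d [1..<Suc K])"
  have eq: "rev (sort (map d [1..<Suc K])) = map d zs"
    unfolding zs_def rev_map[symmetric] rev_is_rev_conv
    by (rule properties_for_sort) auto
  have len: "length zs = K"
    by (simp add: zs_def)
  have "bij_betw ((!) zs) {..<K} {1..K}"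
    by (rule bij_betw_nth) (auto simp: zs_def)
  moreover have "kth_largest d K (Suc j) = d (zs ! j)" if "j < K" for j
    unfolding kth_largest_def eq using that len by simp
  moreover have "antimono_on {..<K} (\<lambda>j. d (zs ! j))"
  proof (intro monotone_onI)
    fix i j assume "i \<in> {..<K}" "j \<in> {..<K}" "i \<le> j"
    then show "d (zs ! j) \<le> d (zs ! i)"
      using sorted_rev_nth_mono[of "map d zs" i j] len
      by (simp add: zs_def rev_map)
  qed
  ultimately show thesis
    using that by blast
qed

text \<open>As \<open>f\<close> is antitone, the \<open>N\<close> largest values of \<open>d\<close>
  give the \<open>N\<close> smallest values of \<open>f\<close>. They are compared with a subset
  \<open>U\<close> of \<open>T\<close> of size exactly \<open>N\<close>; the remaining terms of
  \<open>T\<close> are nonnegative.\<close>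

lemma sum_kth_largest_le:
  fixes f :: "real \<Rightarrow> real"
  assumes "antimono f" "\<And>r. 0 \<le> f r" "T \<subseteq> {1..K}" "N \<le> card T"
  shows "(\<Sum>k = 1..N. f (kth_largest d K k)) \<le> (\<Sum>k\<in>T. f (d k))"
proof -
  obtain \<pi> where \<pi>: "bij_betw \<pi> {..<K} {1..K}"
    "\<And>j. j < K \<Longrightarrow> kth_largest d K (Suc j) = d (\<pi> j)"
    "antimono_on {..<K} (\<lambda>j. d (\<pi> j))"
    using kth_largest_enumeration[of K d] by blast
  obtain U where U: "U \<subseteq> T" "card U = N" "finite U"
    using obtain_subset_with_card_n[OF assms(4)] by blast
  have "U \<subseteq> \<pi> ` {..<K}"
    using U assms(3) \<pi>(1) by (auto simp: bij_betw_def)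
  then obtain V where V: "V \<subseteq> {..<K}" "U = \<pi> ` V"
    by (auto simp: subset_image_iff)
  have inj: "inj_on \<pi> V"
    using V \<pi>(1) by (auto simp: bij_betw_def intro: inj_on_subset)
  have "N \<le> K"
    using card_mono[OF _ assms(3)] assms(4) by simp
  have "(\<Sum>k = 1..N. f (kth_largest d K k)) = (\<Sum>j<N. f (d (\<pi> j)))"
    using \<pi>(2) \<open>N \<le> K\<close>
    by (simp add: sum.atLeast1_atMost_eq)
  also have "\<dots> \<le> (\<Sum>j\<in>V. f (d (\<pi> j)))"
  proof (rule sum_lessThan_le_sum_subset)
    show "mono_on {..<K} (\<lambda>j. f (d (\<pi> j)))"
      using \<pi>(3) assms(1) by (auto simp: monotone_on_def)
    show "card V = N"
      using U V card_image[OF inj] by simp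
  qed (use V in auto)
  also have "\<dots> = (\<Sum>k\<in>U. f (d k))"
    by (simp add: V(2) sum.reindex[OF inj])
  also have "\<dots> \<le> (\<Sum>k\<in>T. f (d k))"
    using U assms(2,3) by (intro sum_mono2) (auto intro: finite_subset)
  finally show ?thesis .
qed

section \<open>The lower bound\<close>

lemma shift_lower_bound:
  assumes "1 \<le> l" "bounded (feasible_region A b)" "facet A b i \<noteq> {}"
    and "pnorm p (row i A) = 1"
    and "row i A \<notin> inverse_feasible_costs A b l p K xt \<tau> \<theta>"
    and "\<theta> \<le> 1"
  shows "(\<Sum>k = 1..nat \<lfloor>(1 - \<theta>) * real K\<rfloor> + 1. max 0 (\<tau> - kth_largest (facet_dist A b l xs i) K k))
    \<le> (\<Sum>k\<in>{1..K}. pnorm l (xs k - xt k))"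
proof -
  define S where "S = {k \<in> {1..K}. \<exists>x\<in>facet A b i. pnorm l (xt k - x) \<le> \<tau>}"
  \<comment> \<open>The points of \<open>xt\<close> farther than \<open>\<tau>\<close> from every
    point of the facet.\<close>
  define T where "T = {1..K} - S"
  have S: "S \<subseteq> {1..K}"
    by (auto simp: S_def)
  have "real (card S) < \<theta> * real K"
  proof (rule ccontr)
    assume "\<not> ?thesis"
    then have "row i A \<in> inverse_feasible_costs A b l p K xt \<tau> \<theta>"
      by (intro row_inverse_feasible[OF assms(4) S]) (simp_all add: S_def)
    then show False
      using assms(5) by contradiction
  qed
  moreover have "card T = K - card S" "card S \<le> K"
    using S card_mono[OF _ S] by (auto simp: T_def card_Diff_subset finite_subset)
  ultimately have "(1 - \<theta>) * real K < real (card T)"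
    by (simp add: algebra_simps of_nat_diff)
  \<comment> \<open>An integer exceeding a real is at least its floor plus 1. Since
    \<open>\<theta> \<le> 1\<close>, the floor is nonnegative and \<open>nat\<close> does not change
    it.\<close>
  then have N: "nat \<lfloor>(1 - \<theta>) * real K\<rfloor> + 1 \<le> card T"
    using assms(6) by (simp add: floor_less_iff nat_less_iff Suc_le_eq)
  have "(\<Sum>k = 1..nat \<lfloor>(1 - \<theta>) * real K\<rfloor> + 1. max 0 (\<tau> - kth_largest (facet_dist A b l xs i) K k))
      \<le> (\<Sum>k\<in>T. max 0 (\<tau> - facet_dist A b l xs i k))"
    using N by (intro sum_kth_largest_le[where f = "\<lambda>r. max 0 (\<tau> - r)"])
      (auto simp: T_def monotone_on_def)
  also have "\<dots> \<le> (\<Sum>k\<in>T. pnorm l (xs k - xt k))"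
  proof (rule sum_mono)
    fix k assume k: "k \<in> T"
    \<comment> \<open>The facet point nearest to the original \<open>xs k\<close>; as
      \<open>k\<close> lies in \<open>T\<close>, it is also farther than \<open>\<tau>\<close> from
      the shifted \<open>xt k\<close>.\<close>
    obtain x where x: "x \<in> facet A b i" "facet_dist A b l xs i k = pnorm l (xs k - x)"
      using facet_dist_attained[OF assms(1-3)] .
    have "\<tau> < pnorm l (xt k - x)"
      using k x(1) by (force simp: T_def S_def)
    also have "\<dots> \<le> pnorm l (xt k - xs k) + pnorm l (xs k - x)"
      using pnorm_triangle[OF assms(1), of "xt k - xs k" "xs k - x"] by simp
    also have "pnorm l (xt k - xs k) = pnorm l (xs k - xt k)"
      by (simp add: pnorm_def infnorm_sub abs_minus_commute)
    finally show "max 0 (\<tau> - facet_dist A b l xs i k) \<le> pnorm l (xs k - xt k)"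
      using x(2) pnorm_nonneg[of l "xs k - xt k"] by simp
  qed
  also have "\<dots> \<le> (\<Sum>k\<in>{1..K}. pnorm l (xs k - xt k))"
    by (intro sum_mono2) (auto simp: T_def pnorm_nonneg)
  finally show ?thesis .
qed

theorem proposition3:
  fixes A :: "real ^ 'n ^ 'm" and b :: "real ^ 'm"
    and l p :: ereal and K :: nat and xhat :: "nat \<Rightarrow> real ^ 'n"
    and \<tau> \<theta> M1 M2 :: real
    and v :: "real ^ 'm" and u :: "nat \<Rightarrow> real" and \<epsilon> :: "nat \<Rightarrow> real ^ 'n"
  assumes "1 \<le> l" and "1 \<le> p"
    and "bounded (feasible_region A b)"
    and "aff_dim (feasible_region A b) = int CARD('n)"
    and "\<And>i. \<not> redundant_constraint A b i"
    and "\<And>i. pnorm p (row i A) = 1"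
    and "1 \<le> K"
    and "0 \<le> \<tau>" and "0 < \<theta>" and "\<theta> \<le> 1"
    and "\<And>i x. x \<in> feasible_region A b \<Longrightarrow> row i A \<bullet> x - b $ i \<le> M1"
    and "\<And>k x. k \<in> {1..K} \<Longrightarrow> x \<in> feasible_region A b \<Longrightarrow> pnorm l (xhat k - x) \<le> M2"
    and "mip_feasible A b l K xhat \<tau> \<theta> M1 M2 v u \<epsilon>"
    and "v \<noteq> 0"
  shows "ereal (Max ((\<lambda>i. \<Sum>k = 1..nat \<lfloor>(1 - \<theta>) * real K\<rfloor> + 1.
                           max 0 (\<tau> - kth_largest (facet_dist A b l xhat i) K k)) ` {i. v $ i = 1}))
         \<le> inverse_stability_value A b l p K xhat \<tau> \<theta>"
proof -
  let ?I = "{i. v $ i = 1}"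
  have "v $ i \<in> {0, 1}" for i
    using assms(13) by (simp add: mip_feasible_def)
  then have "?I \<noteq> {}"
    using assms(14) by (auto simp: vec_eq_iff)
  have "(\<Sum>k = 1..nat \<lfloor>(1 - \<theta>) * real K\<rfloor> + 1. max 0 (\<tau> - kth_largest (facet_dist A b l xhat i) K k))
      \<le> (\<Sum>k\<in>{1..K}. pnorm l (xhat k - xt k))"
    if "i \<in> ?I" and disjoint: "inverse_feasible_costs A b l p K xhat \<tau> \<theta> \<inter>
        inverse_feasible_costs A b l p K xt \<tau> \<theta> = {}" for i xt
  proof (rule shift_lower_bound)
    have i: "v $ i = 1"
      using that by simp
    \<comment> \<open>Since \<open>1 \<le> K\<close>, the perturbed first data point is a point of
      the facet.\<close>
    show "facet A b i \<noteq> {}"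
      using mip_facet[OF assms(13) i, of 1] assms(7) by auto
    show "row i A \<notin> inverse_feasible_costs A b l p K xt \<tau> \<theta>"
      using mip_row_inverse_feasible[OF assms(13) i assms(6)] disjoint by blast
  qed (use assms in auto)
  \<comment> \<open>The bound holds for each \<open>i\<close> and each admissible \<open>xt\<close>,
    hence for the maximum and the infimum; if no \<open>xt\<close> is admissible, the infimum is
    infinite.\<close>
  then show ?thesis
    unfolding inverse_stability_value_def using \<open>?I \<noteq> {}\<close>
    by (intro INF_greatest) (auto simp: Max_le_iff)
qed

end
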